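(* Let $n\ge 6$. If there exists a tight $(3,3)$-design in $F_2^n$, then $n=\frac{m^2+8}{3}$ for some positive integer $m\ge 4$, where either $n\equiv 8\pmod{16}$ and $m$ is divisible by $4$ and not divisible by $3$, or $n\equiv 107\pmod{128}$ and $m\equiv 43\pmod{64}$. Moreover, for $n=24$, any code obtained from the extended binary Golay code $[24,12,8]$ by choosing exactly one codeword from each pair $\{x,-x\}$ of complementary codewords is a tight $(3,3)$-design in $F_2^{24}$.
   Context: $F_2^n$ is the set of binary vectors of length $n$, with Hamming distance $d(x,y)$, and $\langle x,y\rangle:=1-\frac{2d(x,y)}{n}$. The Krawtchouk polynomials $Q_i^{(n)}(t)$ are defined by $Q_0^{(n)}=1$, $Q_1^{(n)}(t)=t$, $ntQ_i^{(n)}(t)=(n-i)Q_{i+1}^{(n)}(t)+iQ_{i-1}^{(n)}(t)$ for $1\le i\le n-1$. For a nonempty $C\subseteq F_2^n$ the moments are $M_i(C):=\sum_{x,y\in C}Q_i^{(n)}(\langle x,y\rangle)$ (over all ordered pairs, including $x=y$). $C$ is a $(3,3)$-design if $M_2(C)=M_4(C)=M_6(C)=0$. A $(3,3)$-design is tight if its cardinality equals $\sum_{i=0}^3\binom{n-1}{i}=\frac{n(n^2-3n+8)}{6}$. For $x\in F_2^n$, $-x$ denotes its complement (the unique point with $d(x,-x)=n$). *)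

theory Defs
  imports
    Complex_Main
    "HOL-Library.Z2"
    "HOL-Computational_Algebra.Polynomial"
    "HOL-Number_Theory.Cong"
    "HOL-Combinatorics.Permutations"
    "Jordan_Normal_Form.Matrix"
begin

abbreviation F2 :: "nat \<Rightarrow> bit vec set" where
  "F2 n \<equiv> carrier_vec n"

definition hamming_dist :: "bit vec \<Rightarrow> bit vec \<Rightarrow> nat" where
  "hamming_dist x y = card {i. i < dim_vec x \<and> x $ i \<noteq> y $ i}"

definition hamming_inner :: "nat \<Rightarrow> bit vec \<Rightarrow> bit vec \<Rightarrow> real" where
  "hamming_inner n x y = 1 - 2 * real (hamming_dist x y) / real n"

text \<open>
  The three-term recurrence solved for its leading term: with \<open>j = i + 1\<close>,
  \<open>Q\<^sub>j\<^sub>+\<^sub>1 = (n t Q\<^sub>j - j Q\<^sub>j\<^sub>-\<^sub>1) / (n - j)\<close>.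
  Only the polynomials of index at most \<open>n\<close> are meaningful; beyond that the
  recurrence divides by zero at \<open>j = n\<close>.
\<close>
fun krawtchouk :: "nat \<Rightarrow> nat \<Rightarrow> real poly" where
  "krawtchouk n 0 = 1"
| "krawtchouk n (Suc 0) = [:0, 1:]"
| "krawtchouk n (Suc (Suc i)) =
     Polynomial.smult (1 / (real n - real (Suc i)))
       (Polynomial.smult (real n) ([:0, 1:] * krawtchouk n (Suc i))
        - Polynomial.smult (real (Suc i)) (krawtchouk n i))"

definition moment :: "nat \<Rightarrow> nat \<Rightarrow> bit vec set \<Rightarrow> real" where
  "moment n i C = (\<Sum>x\<in>C. \<Sum>y\<in>C. poly (krawtchouk n i) (hamming_inner n x y))"

definition design33 :: "nat \<Rightarrow> bit vec set \<Rightarrow> bool" where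
  "design33 n C \<longleftrightarrow> C \<subseteq> F2 n \<and> C \<noteq> {} \<and>
     moment n 2 C = 0 \<and> moment n 4 C = 0 \<and> moment n 6 C = 0"

definition tight_design33 :: "nat \<Rightarrow> bit vec set \<Rightarrow> bool" where
  "tight_design33 n C \<longleftrightarrow> design33 n C \<and> card C = (\<Sum>i=0..3. (n - 1) choose i)"

text \<open>
  The complementary word. It is not the additive inverse of the vector, which over
  the two-element field is the vector itself.
\<close>
definition complement :: "bit vec \<Rightarrow> bit vec" where
  "complement x = vec (dim_vec x) (\<lambda>i. x $ i + 1)"

text \<open>
  The generator \<open>1 + X\<^sup>2 + X\<^sup>4 + X\<^sup>5 + X\<^sup>6 + X\<^sup>1\<^sup>0 + X\<^sup>1\<^sup>1\<close> of the cyclic binary Golay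
  code of length 23. The extended code consists of the words whose first 23 coordinates
  are the coefficients of a multiple of the generator and whose last coordinate is
  the overall parity bit.
\<close>
definition golay_poly :: "bit poly" where
  "golay_poly = [:1, 0, 1, 0, 1, 1, 1, 0, 0, 0, 1, 1:]"

definition standard_extended_golay :: "bit vec set" where
  "standard_extended_golay =
     {x \<in> F2 24. golay_poly dvd (\<Sum>i<23. Polynomial.monom (x $ i) i) \<and> (\<Sum>i<24. x $ i) = 0}"

text \<open>As usual, the code is considered up to a permutation of the 24 coordinates.\<close>
definition extended_golay :: "bit vec set \<Rightarrow> bool" where
  "extended_golay G \<longleftrightarrow>
     (\<exists>p. p permutes {..<24} \<and> G = (\<lambda>x. vec 24 (\<lambda>i. x $ p i)) ` standard_extended_golay)"

end

(* Expanding the Krawtchouk polynomials as elementary symmetric polynomials of signs shows that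
   binom(n,k) * M_k(C) is the sum of squares of the sums over C of the characters of weight k. So a
   (3,3)-design is a code on which all characters of weight 2, 4 and 6 sum to zero.

   If such a code is tight, then w^2 (w^2 - (3n - 8))^2, evaluated at the products w = n - 2 d(x,y)
   and summed over all pairs of codewords, is exhausted by the diagonal. Off the diagonal w is therefore
   0 or a square root of 3n - 8, and by the second moment both kinds occur. This gives m = |w| with
   m^2 = 3n - 8, and n is even because w = 0 occurs, so the case n = 107 (mod 128) never arises. The
   residue n = 4 (mod 32) is excluded since the characters supported on five coordinates force 16 to
   divide |C|.

   For the Golay code it suffices that no word of weight 2, 4 or 6 is orthogonal to the code. Such a word
   satisfies the linear recurrence given by the generator polynomial, hence is determined by 12 bits, and
   all 2^12 cases are evaluated. Passing to one word of each complementary pair halves every character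
   sum of even weight. *)

theory Submission
  imports Defs
begin

section \<open>Elementary symmetric polynomials of signs and the Krawtchouk recurrence\<close>

definition esym :: "'a set \<Rightarrow> nat \<Rightarrow> ('a \<Rightarrow> 'b::comm_ring_1) \<Rightarrow> 'b" where
  "esym A k z = (\<Sum>U | U \<subseteq> A \<and> card U = k. \<Prod>j\<in>U. z j)"

lemma esym_0 [simp]: "finite A \<Longrightarrow> esym A 0 z = 1"
proof -
  assume "finite A"
  then have "{U. U \<subseteq> A \<and> card U = 0} = {{}}"
    by (auto dest: finite_subset)
  then show ?thesis by (simp add: esym_def)
qed

lemma esym_empty_Suc [simp]: "esym {} (Suc k) z = 0"
  unfolding esym_def by (rule sum.neutral) auto

lemma esym_insert_Suc:
  assumes "finite A" "a \<notin> A"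
  shows "esym (insert a A) (Suc k) z = esym A (Suc k) z + z a * esym A k z"
proof -
  let ?P = "\<lambda>B k. {U. U \<subseteq> B \<and> card U = k}"
  have split: "?P (insert a A) (Suc k) = ?P A (Suc k) \<union> insert a ` ?P A k"
  proof (intro equalityI subsetI)
    fix U assume U: "U \<in> ?P (insert a A) (Suc k)"
    show "U \<in> ?P A (Suc k) \<union> insert a ` ?P A k"
    proof (cases "a \<in> U")
      case True
      with U have "U - {a} \<in> ?P A k" "U = insert a (U - {a})"
        by (auto simp: card_Diff_singleton)
      then show ?thesis by blast
    qed (use U in auto)
  next
    fix U assume "U \<in> ?P A (Suc k) \<union> insert a ` ?P A k"
    then show "U \<in> ?P (insert a A) (Suc k)"
      using assms by (auto simp: card_insert_if finite_subset)
  qed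
  have inj: "inj_on (insert a) (?P A k)"
    using assms(2) by (auto simp: inj_on_def)
  have "(\<Sum>U \<in> insert a ` ?P A k. \<Prod>j\<in>U. z j) = z a * esym A k z"
    unfolding esym_def sum_distrib_left sum.reindex[OF inj] comp_def
  proof (intro sum.cong refl)
    fix U assume "U \<in> ?P A k"
    then have "finite U" "a \<notin> U" using assms by (auto intro: finite_subset)
    then show "prod z (insert a U) = z a * prod z U" by simp
  qed
  moreover have "finite (?P A j)" for j
    using assms(1) by simp
  moreover have "?P A (Suc k) \<inter> insert a ` ?P A k = {}"
    using assms(2) by auto
  ultimately show ?thesis
    unfolding split by (subst esym_def) (simp add: sum.union_disjoint split esym_def)
qed

lemma esym_Suc_0: "finite A \<Longrightarrow> esym A (Suc 0) z = sum z A"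
  by (induction A rule: finite_induct) (simp_all add: esym_insert_Suc)

text \<open>Expand the product on the left. A factor \<open>z j\<close> either enlarges a set of
  size \<open>k + 1\<close>, and every set of size \<open>k + 2\<close> arises \<open>k + 2\<close>
  times, or it cancels because \<open>z j * z j = 1\<close>, and every set of size \<open>k\<close>
  arises from \<open>card A - k\<close> choices of \<open>j\<close>. Induction on \<open>A\<close>
  replaces this count.\<close>

lemma esym_rec:
  fixes z :: "'a \<Rightarrow> real"
  assumes "finite A" "\<And>j. j \<in> A \<Longrightarrow> z j * z j = 1"
  shows "sum z A * esym A (Suc k) z =
    (real k + 2) * esym A (Suc (Suc k)) z + (real (card A) - real k) * esym A k z"
  using assms
proof (induction A arbitrary: k rule: finite_induct)
  case (insert a A)
  let ?e = "\<lambda>k. esym A k z"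
  have IH: "sum z A * ?e (Suc k) = (real k + 2) * ?e (Suc (Suc k)) + (real (card A) - real k) * ?e k" for k
    using insert by simp
  have za: "z a * z a = 1" using insert by simp
  have sq: "z a * (z a * t) = t" for t using za by (simp flip: mult.assoc)
  show ?case
  \<comment> \<open>\<open>esym_insert_Suc\<close> lowers the index, so the terms of index
    \<open>k\<close> need \<open>k = Suc l\<close>; at index 0 they are constant.\<close>
  proof (cases k)
    case 0
    have "esym A (Suc 0) z = sum z A" using insert by (simp add: esym_Suc_0)
    then show ?thesis using IH[of 0] insert 0
      by (simp add: esym_insert_Suc algebra_simps sq za)
  next
    case (Suc l)
    have "sum z (insert a A) * esym (insert a A) (Suc k) z =
      sum z A * ?e (Suc k) + z a * (sum z A * ?e (Suc l)) + z a * ?e (Suc k) + ?e k"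
      using insert Suc by (simp add: esym_insert_Suc algebra_simps sq)
    also have "\<dots> = (real k + 2) * (?e (Suc (Suc k)) + z a * ?e (Suc k))
        + (real (card (insert a A)) - real k) * (?e k + z a * ?e l)"
      unfolding IH using insert Suc by (simp add: algebra_simps)
    finally show ?thesis
      using insert Suc by (simp add: esym_insert_Suc)
  qed
next
  case empty
  then show ?case by (cases k) auto
qed

lemma binomial_Suc_mult:
  assumes "k \<le> n"
  shows "(real k + 1) * real (n choose Suc k) = (real n - real k) * real (n choose k)"
  using assms binomial_absorb_comp[of n k]
  by (metis add.commute binomial_absorption of_nat_Suc of_nat_diff of_nat_mult)

text \<open>Dividing \<open>esym_rec\<close> by binomial coefficients gives the defining recurrence
  of the Krawtchouk polynomials at \<open>sum z A / real n\<close>. The bound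
  \<open>k \<le> n\<close> keeps the denominators of that recurrence nonzero.\<close>

lemma esym_eq_krawtchouk:
  fixes z :: "'a \<Rightarrow> real"
  assumes A: "finite A" "\<And>j. j \<in> A \<Longrightarrow> z j * z j = 1"
    and n: "card A = n" "n > 0" and "k \<le> n"
  shows "esym A k z = real (n choose k) * poly (krawtchouk n k) (sum z A / real n)"
  using \<open>k \<le> n\<close>
proof (induction k rule: induct_nat_012)
  case 0
  then show ?case using A by simp
next
  case 1
  then show ?case using A n by (simp add: esym_Suc_0)
next
  case (ge2 k)
  let ?q = "\<lambda>k. poly (krawtchouk n k) (sum z A / real n)"
  have pos: "real n - real k - 1 > 0" using ge2.prems by linarith
  have q: "(real n - real k - 1) * ?q (Suc (Suc k)) = sum z A * ?q (Suc k) - (real k + 1) * ?q k"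
    using pos n by (simp add: field_simps)
  have b1: "(real k + 1) * real (n choose Suc k) = (real n - real k) * real (n choose k)"
    using binomial_Suc_mult[of k n] ge2.prems by simp
  have b2: "(real k + 2) * real (n choose Suc (Suc k)) = (real n - real k - 1) * real (n choose Suc k)"
    using binomial_Suc_mult[of "Suc k" n] ge2.prems by (simp add: algebra_simps)
  have "(real k + 2) * esym A (Suc (Suc k)) z =
     sum z A * (real (n choose Suc k) * ?q (Suc k)) - (real n - real k) * (real (n choose k) * ?q k)"
    using esym_rec[of A z k] A ge2 n by simp
  also have "\<dots> = real (n choose Suc k) * (sum z A * ?q (Suc k) - (real k + 1) * ?q k)"
    using arg_cong[OF b1, of "\<lambda>x. x * ?q k"] by (simp add: algebra_simps)
  also have "\<dots> = (real k + 2) * (real (n choose Suc (Suc k)) * ?q (Suc (Suc k)))"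
    unfolding q[symmetric] using arg_cong[OF b2, of "\<lambda>x. x * ?q (Suc (Suc k))"]
    by (simp add: algebra_simps del: krawtchouk.simps)
  finally show ?case by (simp del: krawtchouk.simps)
qed

section \<open>Characters of the binary space and moments of a code\<close>

definition bsign :: "bit \<Rightarrow> real" where
  "bsign b = (if b = 0 then 1 else - 1)"

lemma bsign_square [simp]: "bsign b * bsign b = 1"
  by (simp add: bsign_def)

lemma bsign_add: "bsign (a + b) = bsign a * bsign b"
  by (cases a; cases b) (simp_all add: bsign_def)

definition character :: "nat set \<Rightarrow> bit vec \<Rightarrow> real" where
  "character U x = (\<Prod>j\<in>U. bsign (x $ j))"

lemma character_empty [simp]: "character {} x = 1"
  by (simp add: character_def)

text \<open>The scalar product of the two sign vectors, an integer equal to n times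
  \<open>hamming_inner\<close> on words of length n.\<close>

definition sprod :: "nat \<Rightarrow> bit vec \<Rightarrow> bit vec \<Rightarrow> real" where
  "sprod n x y = (\<Sum>j<n. bsign (x $ j) * bsign (y $ j))"

lemma sprod_self: "sprod n x x = real n"
  by (simp add: sprod_def)

lemma sprod_eq_hamming:
  assumes "x \<in> F2 n" "y \<in> F2 n"
  shows "sprod n x y = real n - 2 * real (hamming_dist x y)"
proof -
  have "sprod n x y = (\<Sum>j<n. 1 - 2 * of_bool (x $ j \<noteq> y $ j))"
    unfolding sprod_def by (intro sum.cong) (auto simp: bsign_def)
  also have "\<dots> = real n - 2 * (\<Sum>j<n. of_bool (x $ j \<noteq> y $ j))"
    by (simp add: sum_subtractf sum_distrib_left)
  also have "(\<Sum>j<n. of_bool (x $ j \<noteq> y $ j)) = real (hamming_dist x y)"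
    using assms unfolding hamming_dist_def
    by (subst sum_of_bool_eq) (auto intro!: arg_cong[where f = card])
  finally show ?thesis .
qed

text \<open>The kernel of the double sum splits as the sum over \<open>U\<close> of
  \<open>character U x * character U y\<close>, so each \<open>U\<close> contributes a square. The
  second identity keeps the kernel as \<open>esym\<close>, the form in which it occurs in powers of
  \<open>sprod\<close>.\<close>

lemma moment_eq_sum_squares:
  assumes C: "C \<subseteq> F2 n" and "n > 0" "k \<le> n"
  shows "real (n choose k) * moment n k C =
    (\<Sum>U | U \<subseteq> {..<n} \<and> card U = k. (\<Sum>x\<in>C. character U x)\<^sup>2)" (is "_ = ?R")
    and "(\<Sum>x\<in>C. \<Sum>y\<in>C. esym {..<n} k (\<lambda>j. bsign (x $ j) * bsign (y $ j))) =
      real (n choose k) * moment n k C" (is ?th2)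
proof -
  have "esym {..<n} k (\<lambda>j. bsign (x $ j) * bsign (y $ j))
     = real (n choose k) * poly (krawtchouk n k) (hamming_inner n x y)" if "x \<in> C" "y \<in> C" for x y
  proof -
    have "sprod n x y / real n = hamming_inner n x y"
      using that C \<open>n > 0\<close>
      by (subst sprod_eq_hamming) (auto simp: hamming_inner_def diff_divide_distrib)
    then have "(\<Sum>j<n. bsign (x $ j) * bsign (y $ j)) / real n = hamming_inner n x y"
      by (simp add: sprod_def)
    then show ?thesis
      using esym_eq_krawtchouk[of "{..<n}" "\<lambda>j. bsign (x $ j) * bsign (y $ j)" n k] assms
      by (simp add: mult.assoc mult.left_commute)
  qed
  then show th2: ?th2
    by (simp add: moment_def sum_distrib_left)
  have "esym {..<n} k (\<lambda>j. bsign (x $ j) * bsign (y $ j)) =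
      (\<Sum>U | U \<subseteq> {..<n} \<and> card U = k. character U x * character U y)" for x y
    by (simp add: esym_def character_def prod.distrib)
  then have "(\<Sum>x\<in>C. \<Sum>y\<in>C. esym {..<n} k (\<lambda>j. bsign (x $ j) * bsign (y $ j))) =
    (\<Sum>x\<in>C. \<Sum>y\<in>C. \<Sum>U | U \<subseteq> {..<n} \<and> card U = k. character U x * character U y)"
    by simp
  also have "\<dots> = (\<Sum>x\<in>C. \<Sum>U | U \<subseteq> {..<n} \<and> card U = k. \<Sum>y\<in>C. character U x * character U y)"
    by (intro sum.cong refl sum.swap)
  also have "\<dots> = (\<Sum>U | U \<subseteq> {..<n} \<and> card U = k. \<Sum>x\<in>C. \<Sum>y\<in>C. character U x * character U y)"
    by (rule sum.swap)
  also have "\<dots> = ?R"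
    by (simp add: power2_eq_square sum_product)
  finally show "real (n choose k) * moment n k C = ?R"
    using th2 by simp
qed

text \<open>A vanishing sum of squares has only vanishing terms; this turns a condition on moments
  into one on single characters.\<close>

lemma sum_character_eq_0:
  assumes "C \<subseteq> F2 n" "moment n (card U) C = 0" "U \<subseteq> {..<n}" "U \<noteq> {}"
  shows "(\<Sum>x\<in>C. character U x) = 0"
proof -
  have U: "finite U" "card U \<le> n" "n > 0"
    using assms finite_subset[of U "{..<n}"] card_mono[of "{..<n}" U] by auto
  then have "(\<Sum>V | V \<subseteq> {..<n} \<and> card V = card U. (\<Sum>x\<in>C. character V x)\<^sup>2) = 0"
    using moment_eq_sum_squares(1)[of C n "card U"] assms by simp
  then have "\<forall>V\<in>{V. V \<subseteq> {..<n} \<and> card V = card U}. (\<Sum>x\<in>C. character V x)\<^sup>2 = 0"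
    by (subst (asm) sum_nonneg_eq_0_iff) auto
  then show ?thesis using assms(3) by simp
qed

section \<open>Even power sums and the cardinality of a tight design\<close>

text \<open>Multiply by \<open>w\<close> repeatedly and rewrite each \<open>w * e k\<close> by
  \<open>esym_rec\<close>. The constant terms are the second, fourth and sixth moments of a sum of n
  independent random signs. Besides them only \<open>e 2\<close>, \<open>e 4\<close> and
  \<open>e 6\<close> occur, and these sum to zero over the pairs of a design.\<close>

lemma power_sum_signs_via_esym:
  fixes z :: "'a \<Rightarrow> real"
  assumes A: "finite A" "\<And>j. j \<in> A \<Longrightarrow> z j * z j = 1"
  defines "w \<equiv> sum z A" and "n \<equiv> real (card A)" and "e \<equiv> \<lambda>k. esym A k z"
  shows "w ^ 2 = 2 * e 2 + n"
    and "w ^ 4 = 24 * e 4 + (12 * n - 16) * e 2 + n * (3 * n - 2)"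
    and "w ^ 6 = 720 * e 6 + (360 * n - 960) * e 4 + (60 * (n - 2)\<^sup>2 + 30 * n\<^sup>2 - 60 * n + 32) * e 2
            + n * (15 * n\<^sup>2 - 30 * n + 16)"
proof -
  have r: "w * e (Suc k) = (real k + 2) * e (Suc (Suc k)) + (n - real k) * e k" for k
    unfolding w_def e_def n_def by (rule esym_rec[OF A])
  have e01: "e 0 = 1" "e 1 = w"
    using A by (simp_all add: e_def w_def esym_Suc_0)
  have r1: "w * w = 2 * e 2 + n"
    and r2: "w * e 2 = 3 * e 3 + (n - 1) * w"
    and r3: "w * e 3 = 4 * e 4 + (n - 2) * e 2"
    and r4: "w * e 4 = 5 * e 5 + (n - 3) * e 3"
    and r5: "w * e 5 = 6 * e 6 + (n - 4) * e 4"
    using r[of 0] r[of 1] r[of 2] r[of 3] r[of 4] e01 by (simp_all add: eval_nat_numeral)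
  show w2: "w ^ 2 = 2 * e 2 + n" using r1 by (simp add: power2_eq_square)
  have w3: "w ^ 3 = 6 * e 3 + (3 * n - 2) * w"
  proof -
    have "w ^ 3 = 2 * (w * e 2) + n * w"
      using arg_cong[OF w2, of "\<lambda>t. w * t"] by (simp add: eval_nat_numeral algebra_simps)
    then show ?thesis unfolding r2 by (simp add: algebra_simps)
  qed
  show w4: "w ^ 4 = 24 * e 4 + (12 * n - 16) * e 2 + n * (3 * n - 2)"
  proof -
    have "w ^ 4 = 6 * (w * e 3) + (3 * n - 2) * (w * w)"
      using arg_cong[OF w3, of "\<lambda>t. w * t"] by (simp add: eval_nat_numeral algebra_simps)
    then show ?thesis unfolding r3 r1 by (simp add: algebra_simps)
  qed
  have w5: "w ^ 5 = 120 * e 5 + (60 * n - 120) * e 3 + (15 * n\<^sup>2 - 30 * n + 16) * w"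
  proof -
    have "w ^ 5 = 24 * (w * e 4) + (12 * n - 16) * (w * e 2) + n * (3 * n - 2) * w"
      using arg_cong[OF w4, of "\<lambda>t. w * t"] by (simp add: eval_nat_numeral algebra_simps)
    then show ?thesis unfolding r4 r2 by (simp add: algebra_simps power2_eq_square)
  qed
  have "w ^ 6 = 120 * (w * e 5) + (60 * n - 120) * (w * e 3) + (15 * n\<^sup>2 - 30 * n + 16) * (w * w)"
    using arg_cong[OF w5, of "\<lambda>t. w * t"] by (simp add: eval_nat_numeral algebra_simps)
  then show "w ^ 6 = 720 * e 6 + (360 * n - 960) * e 4 + (60 * (n - 2)\<^sup>2 + 30 * n\<^sup>2 - 60 * n + 32) * e 2
            + n * (15 * n\<^sup>2 - 30 * n + 16)"
    unfolding r5 r3 r1 by (simp add: algebra_simps power2_eq_square)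
qed

text \<open>The closed form n(n^2 - 3n + 8)/6, cleared of its denominator and its negative term to
  stay within the naturals.\<close>

lemma sum_choose_upto_3:
  assumes "n > 0"
  shows "6 * (\<Sum>i=0..3. (n - 1) choose i) + 3 * n ^ 2 = n * (n ^ 2 + 8)"
proof -
  obtain m where n: "n = Suc m" using assms gr0_conv_Suc by blast
  have two: "2 * (k choose 2) + k = k * k" for k :: nat
    by (induction k) (auto simp: numeral_2_eq_2)
  have three: "6 * (k choose 3) + 3 * (k * k) = k * (k * k) + 2 * k" for k :: nat
  proof (induction k)
    case (Suc k)
    have "(Suc k choose 3) = (k choose 2) + (k choose 3)"
      by (simp add: numeral_2_eq_2 numeral_3_eq_3)
    then show ?case using Suc two[of k] by (simp add: algebra_simps)
  qed simp
  have "(\<Sum>i=0..3. m choose i) = 1 + m + (m choose 2) + (m choose 3)"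
    by (simp add: numeral_2_eq_2 numeral_3_eq_3)
  then show ?thesis
    using two[of m] three[of m] by (simp add: n power2_eq_square algebra_simps)
qed

section \<open>Divisibility of the cardinality and its consequences for n\<close>

text \<open>Both products expand over the subsets of \<open>S\<close>, the second with the signs
  \<open>(- 1) ^ card U\<close>; even subsets are doubled and odd ones cancel.\<close>

lemma sum_Pow_even_character:
  assumes "finite S"
  shows "(\<Sum>U | U \<subseteq> S. (1 + (- 1) ^ card U) * character U x) =
    (\<Prod>j\<in>S. 1 + bsign (x $ j)) + (\<Prod>j\<in>S. 1 - bsign (x $ j))"
proof -
  have "(\<Prod>j\<in>S. bsign (x $ j) + 1) = (\<Sum>U\<in>Pow S. character U x)"
    using prod_add[OF assms, of "\<lambda>j. bsign (x $ j)" "\<lambda>_. 1"] by (simp add: character_def)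
  moreover have "(\<Prod>j\<in>S. - bsign (x $ j) + 1) = (\<Sum>U\<in>Pow S. (- 1) ^ card U * character U x)"
    using prod_add[OF assms, of "\<lambda>j. - bsign (x $ j)" "\<lambda>_. 1"]
    by (simp add: character_def prod_uminus)
  ultimately show ?thesis
    by (simp add: Pow_def distrib_right sum.distrib add.commute)
qed

text \<open>Only the words that are constant on the first five coordinates survive the summation over the even
  subsets of these coordinates, each with weight 32.\<close>
lemma sixteen_dvd_card:
  assumes C: "C \<subseteq> F2 n" and "n \<ge> 5" and m: "moment n 2 C = 0" "moment n 4 C = 0"
  shows "16 dvd card C"
\<comment> \<open>An infinite \<open>C\<close> would have \<open>card C = 0\<close>, which 16
  divides.\<close>
proof (cases "finite C")
  case True
  define S where "S = {..<5::nat}"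
  define h where "h x = (\<Sum>U | U \<subseteq> S. (1 + (- 1) ^ card U) * character U x)" for x
  define K where "K = {x \<in> C. h x \<noteq> 0}"
  have "h x = (\<Prod>j\<in>S. 1 + bsign (x $ j)) + (\<Prod>j\<in>S. 1 - bsign (x $ j))" for x
    unfolding h_def by (rule sum_Pow_even_character) (simp add: S_def)
  then have h: "h x = 0 \<or> h x = 32" for x
    by (auto simp: S_def lessThan_nat_numeral bsign_def)
  have "(\<Sum>x\<in>C. (1 + (- 1) ^ card U) * character U x) = (if U = {} then 2 * real (card C) else 0)"
    if "U \<subseteq> S" for U
  proof -
    have "card U \<le> 5"
      using that card_mono[of S U] by (simp add: S_def)
    \<comment> \<open>A set of five coordinates has even subsets of sizes 0, 2 and 4 only, so the
      moments 2 and 4 control all of them.\<close>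
    then have "card U = 0 \<or> card U = 2 \<or> card U = 4 \<or> odd (card U)"
      by presburger
    moreover have "finite U" using that finite_subset by (auto simp: S_def)
    moreover have "(\<Sum>x\<in>C. character U x) = 0" if "card U \<in> {2, 4}"
      using that m \<open>U \<subseteq> S\<close> \<open>n \<ge> 5\<close> by (intro sum_character_eq_0[OF C]) (auto simp: S_def)
    ultimately show ?thesis
      by (auto simp flip: sum_distrib_left)
  qed
  then have "(\<Sum>x\<in>C. h x) = (\<Sum>U | U \<subseteq> S. if U = {} then 2 * real (card C) else 0)"
    unfolding h_def by (subst sum.swap) (auto intro!: sum.cong)
  also have "\<dots> = 2 * real (card C)"
    by (subst sum.delta) (auto simp: S_def)
  also have "(\<Sum>x\<in>C. h x) = (\<Sum>x\<in>K. 32)"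
    using True h by (intro sum.mono_neutral_cong_right) (auto simp: K_def)
  finally have "card C = 16 * card K" by simp
  then show ?thesis by simp
qed simp

text \<open>A descent on powers of 2: m = 2s and n = 4k, then s = 2r and k = 2l, where 3l = 2r^2 + 1
  forces l to be odd. Hence n = 8l is 8 modulo 16. Modulo 3 the square of m is -8, hence
  nonzero.\<close>

lemma tight_design33_order:
  fixes n :: nat and m :: int
  assumes m: "m\<^sup>2 = 3 * int n - 8" and n: "even n" and d: "32 dvd int n * ((int n)\<^sup>2 - 3 * int n + 8)"
  shows "[n = 8] (mod 16) \<and> 4 dvd m \<and> \<not> 3 dvd m"
proof -
  from n have "even (m\<^sup>2)" unfolding m by simp
  then obtain s where s: "m = 2 * s" by auto
  then have s2: "3 * int n = 4 * (s\<^sup>2 + 2)" using m by (simp add: power2_eq_square)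
  then have "4 dvd int n" by presburger
  then obtain k where k: "int n = 4 * k" by blast
  with s2 have s2: "s\<^sup>2 = 3 * k - 2" by simp
  \<comment> \<open>An odd s would mean n = 4 (mod 32). Then k is odd and the product in
    \<open>d\<close> is 16 times an odd number.\<close>
  have "even s"
  proof (rule ccontr)
    assume "odd s"
    with s2 have k2: "odd k" by (metis dvd_diff_right_iff dvd_mult even_power dvd_refl odd_one even_numeral pos2)
    define X where "X = k * (4 * k\<^sup>2 - 3 * k + 2)"
    have "int n * ((int n)\<^sup>2 - 3 * int n + 8) = 16 * X"
      unfolding k X_def by (simp add: power2_eq_square algebra_simps)
    with d have "even X" by presburger
    with k2 show False by (simp add: X_def)
  qed
  then obtain r where r: "s = 2 * r" by auto
  with s2 have r2: "4 * r\<^sup>2 + 2 = 3 * k" by (simp add: power2_eq_square)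
  then have "even (3 * k)" by (metis dvd_add dvd_mult2 dvd_refl even_numeral)
  then obtain l where l: "k = 2 * l" by auto
  with r2 have "2 * r\<^sup>2 + 1 = 3 * l" by simp
  then have "odd (3 * l)" by (metis even_plus_one_iff even_mult_iff even_numeral)
  then have "odd l" by simp
  then have "int n mod 16 = 8" using k l by presburger
  then have "int (n mod 16) = int 8" by (simp add: zmod_int)
  then have "[n = 8] (mod 16)" unfolding cong_def by (simp only: of_nat_eq_iff) simp
  moreover have "\<not> 3 dvd m"
  proof
    assume "3 dvd m"
    then have "3 dvd m\<^sup>2" by (simp add: power2_eq_square)
    then show False unfolding m by presburger
  qed
  ultimately show ?thesis using s r by simp
qed

section \<open>Scalar products in a tight design\<close>

text \<open>Equality in a linear programming bound: the double sum of the nonnegative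
  \<open>F\<close> is fixed by the three moments, and at this cardinality it equals the diagonal
  part alone, so \<open>F\<close> vanishes at all other pairs.\<close>

lemma tight_design33_sprod:
  assumes n: "n \<ge> 6" and C: "tight_design33 n C"
  shows "finite C" "6 * real (card C) = real n * ((real n)\<^sup>2 - 3 * real n + 8)"
    and "(\<Sum>x\<in>C. \<Sum>y\<in>C. (sprod n x y)\<^sup>2) = (real (card C))\<^sup>2 * real n"
    and "\<And>x y. x \<in> C \<Longrightarrow> y \<in> C \<Longrightarrow> x \<noteq> y \<Longrightarrow> sprod n x y = 0 \<or> (sprod n x y)\<^sup>2 = 3 * real n - 8"
proof -
  define N where "N = real (card C)"
  let ?n = "real n"
  have sub: "C \<subseteq> F2 n" and M: "moment n 2 C = 0" "moment n 4 C = 0" "moment n 6 C = 0"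
    and c: "card C = (\<Sum>i=0..3. (n - 1) choose i)"
    using C by (auto simp: tight_design33_def design33_def)
  have cn: "6 * card C + 3 * n ^ 2 = n * (n ^ 2 + 8)"
    using sum_choose_upto_3[of n] c n by simp
  have "real (6 * card C + 3 * n ^ 2) = real (n * (n ^ 2 + 8))" by (simp only: cn)
  then show N6: "6 * real (card C) = ?n * (?n\<^sup>2 - 3 * ?n + 8)"
    by (simp add: algebra_simps power2_eq_square)
  \<comment> \<open>A positive \<open>card\<close> also yields finiteness, since infinite sets have
    \<open>card\<close> 0.\<close>
  have "card C > 0" unfolding c by (rule sum_pos2[of _ 0]) auto
  then show fin: "finite C" using card_ge_0_finite by blast
  define e where "e k x y = esym {..<n} k (\<lambda>j. bsign (x $ j) * bsign (y $ j))" for k x y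
  have e: "(\<Sum>x\<in>C. \<Sum>y\<in>C. e k x y) = 0" if "k \<in> {2, 4, 6}" for k
    using moment_eq_sum_squares(2)[OF sub, of k] that n M by (auto simp: e_def)
  have w: "(sprod n x y) ^ 2 = 2 * e 2 x y + ?n"
    "(sprod n x y) ^ 4 = 24 * e 4 x y + (12 * ?n - 16) * e 2 x y + ?n * (3 * ?n - 2)"
    "(sprod n x y) ^ 6 = 720 * e 6 x y + (360 * ?n - 960) * e 4 x y
        + (60 * (?n - 2)\<^sup>2 + 30 * ?n\<^sup>2 - 60 * ?n + 32) * e 2 x y
            + ?n * (15 * ?n\<^sup>2 - 30 * ?n + 16)" for x y
    using power_sum_signs_via_esym[of "{..<n}" "\<lambda>j. bsign (x $ j) * bsign (y $ j)"]
    by (simp_all add: e_def sprod_def mult.assoc mult.left_commute)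
  have S2: "(\<Sum>x\<in>C. \<Sum>y\<in>C. (sprod n x y) ^ 2) = N\<^sup>2 * ?n"
    and S4: "(\<Sum>x\<in>C. \<Sum>y\<in>C. (sprod n x y) ^ 4) = N\<^sup>2 * (?n * (3 * ?n - 2))"
    and S6: "(\<Sum>x\<in>C. \<Sum>y\<in>C. (sprod n x y) ^ 6) = N\<^sup>2 * (?n * (15 * ?n\<^sup>2 - 30 * ?n + 16))"
    unfolding w sum.distrib by (simp_all add: e N_def power2_eq_square flip: sum_distrib_left)
  show "(\<Sum>x\<in>C. \<Sum>y\<in>C. (sprod n x y)\<^sup>2) = (real (card C))\<^sup>2 * ?n"
    using S2 by (simp add: N_def)
  \<comment> \<open>At a sum of signs, t(t^2 - (3n - 8)) is 6 times the sum of the elementary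
    symmetric polynomials of degrees 1 and 3, whence the constant 3n - 8; \<open>F\<close> is its
    square.\<close>
  define F where "F t = t\<^sup>2 * (t\<^sup>2 - (3 * ?n - 8))\<^sup>2" for t :: real
  have F0: "F t \<ge> 0" for t by (simp add: F_def)
  have "F t = t ^ 6 - 2 * (3 * ?n - 8) * t ^ 4 + (3 * ?n - 8)\<^sup>2 * t ^ 2" for t
    by (simp add: F_def eval_nat_numeral algebra_simps)
  then have "(\<Sum>x\<in>C. \<Sum>y\<in>C. F (sprod n x y)) =
    N\<^sup>2 * (?n * (15 * ?n\<^sup>2 - 30 * ?n + 16)) - 2 * (3 * ?n - 8) * (N\<^sup>2 * (?n * (3 * ?n - 2)))
      + (3 * ?n - 8)\<^sup>2 * (N\<^sup>2 * ?n)"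
    by (simp add: sum.distrib sum_subtractf S2 S4 S6 flip: sum_distrib_left)
  \<comment> \<open>The three moment terms collapse to 6n(n^2 - 3n + 8). Replacing
    \<open>6 * N\<close> by its closed form then produces the square in \<open>F ?n\<close>.\<close>
  also have "\<dots> = N * (6 * N) * (?n * (?n\<^sup>2 - 3 * ?n + 8))"
    by (simp add: power2_eq_square algebra_simps)
  also have "\<dots> = N * F ?n"
    unfolding N6[folded N_def] by (simp add: F_def power2_eq_square algebra_simps)
  also have "\<dots> = (\<Sum>x\<in>C. F (sprod n x x))"
    by (simp add: sprod_self N_def)
  finally have "(\<Sum>x\<in>C. (\<Sum>y\<in>C. F (sprod n x y)) - F (sprod n x x)) = 0"
    by (simp add: sum_subtractf)
  then have "(\<Sum>x\<in>C. \<Sum>y\<in>C - {x}. F (sprod n x y)) = 0"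
    using fin by (simp add: sum_diff1)
  then have Z: "\<forall>x\<in>C. (\<Sum>y\<in>C - {x}. F (sprod n x y)) = 0"
    using fin F0 by (subst (asm) sum_nonneg_eq_0_iff) (auto intro: sum_nonneg)
  show "sprod n x y = 0 \<or> (sprod n x y)\<^sup>2 = 3 * ?n - 8" if "x \<in> C" "y \<in> C" "x \<noteq> y" for x y
  proof -
    have "\<forall>y\<in>C - {x}. F (sprod n x y) = 0"
      using bspec[OF Z \<open>x \<in> C\<close>] fin F0 by (subst (asm) sum_nonneg_eq_0_iff) auto
    then show ?thesis using that by (auto simp: F_def)
  qed
qed

text \<open>Both off-diagonal kinds of scalar product occur: the value 0 makes n even, and a nonzero
  one has the absolute value m.\<close>

lemma tight_design33_parameters:
  assumes n: "n \<ge> 6" and C: "tight_design33 n C"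
  obtains m :: nat where "m \<ge> 4" "m\<^sup>2 + 8 = 3 * n" "[n = 8] (mod 16)" "4 dvd m" "\<not> 3 dvd m"
proof -
  note tight = tight_design33_sprod[OF n C]
  let ?n = "real n"
  define N where "N = real (card C)"
  have sub: "C \<subseteq> F2 n" and M: "moment n 2 C = 0" "moment n 4 C = 0" "C \<noteq> {}"
    using C by (auto simp: tight_design33_def design33_def)
  have fin: "finite C" by (fact tight)
  have N: "N > 0" using M fin by (simp add: N_def card_gt_0_iff)
  have N6: "6 * N = ?n * (?n\<^sup>2 - 3 * ?n + 8)" using tight(2) by (simp add: N_def)
  have nn: "?n * ?n \<ge> 6 * ?n" using n by (intro mult_right_mono) auto
  have split: "(\<Sum>x\<in>C. \<Sum>y\<in>C. (sprod n x y)\<^sup>2) = (\<Sum>x\<in>C. ?n\<^sup>2 + (\<Sum>y\<in>C - {x}. (sprod n x y)\<^sup>2))"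
    using fin by (intro sum.cong refl) (simp add: sum.remove sprod_self)
  \<comment> \<open>The second moment when all off-diagonal squares equal one number
    \<open>c\<close>; it refutes both \<open>c = 3 * ?n - 8\<close> and
    \<open>c = 0\<close>.\<close>
  have const: "?n\<^sup>2 + (N - 1) * c = N * ?n"
    if "\<And>x y. x \<in> C \<Longrightarrow> y \<in> C \<Longrightarrow> x \<noteq> y \<Longrightarrow> (sprod n x y)\<^sup>2 = c" for c
  proof -
    have "(\<Sum>y\<in>C - {x}. (sprod n x y)\<^sup>2) = (N - 1) * c" if "x \<in> C" for x
    proof -
      have "(\<Sum>y\<in>C - {x}. (sprod n x y)\<^sup>2) = (\<Sum>y\<in>C - {x}. c)"
        using that \<open>\<And>x y. x \<in> C \<Longrightarrow> y \<in> C \<Longrightarrow> x \<noteq> y \<Longrightarrow> (sprod n x y)\<^sup>2 = c\<close>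
        by (intro sum.cong) auto
      then show ?thesis
        using that N fin by (simp add: N_def of_nat_diff Suc_le_eq card_gt_0_iff)
    qed
    then have "N * (?n\<^sup>2 + (N - 1) * c) = N * (N * ?n)"
      using tight(3) unfolding split by (simp add: N_def power2_eq_square)
    then show ?thesis using N by simp
  qed
  have "\<exists>x\<in>C. \<exists>y\<in>C. sprod n x y = 0"
  proof (rule ccontr)
    assume "\<not> ?thesis"
    then have "?n\<^sup>2 + (N - 1) * (3 * ?n - 8) = N * ?n"
      using tight(4) by (intro const) blast
    \<comment> \<open>The left side is positive, while the right side is negative because n^2 is at
      least 6n.\<close>
    then have "N * (2 * ?n - 8) = 3 * ?n - 8 - ?n * ?n"
      by (simp add: power2_eq_square algebra_simps)
    moreover have "N * (2 * ?n - 8) > 0" using N n by simp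
    ultimately show False using nn n by linarith
  qed
  then obtain x y where "x \<in> C" "y \<in> C" "sprod n x y = 0" by blast
  then have "?n = real (2 * hamming_dist x y)"
    using sprod_eq_hamming[of x n y] sub by auto
  then have "even n" by (metis dvd_triv_left of_nat_eq_iff)
  have "\<exists>x\<in>C. \<exists>y\<in>C. (sprod n x y)\<^sup>2 = 3 * ?n - 8"
  proof (rule ccontr)
    assume "\<not> ?thesis"
    then have "?n\<^sup>2 + (N - 1) * 0 = N * ?n"
      using tight(4) by (intro const) auto
    then have "N = ?n" using n by (simp add: power2_eq_square)
    then have "?n\<^sup>2 - 3 * ?n + 8 = 6" using N6 n by simp
    then show False using nn n by (simp add: power2_eq_square)
  qed
  then obtain x y where xy: "x \<in> C" "y \<in> C" "(sprod n x y)\<^sup>2 = 3 * ?n - 8" by blast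
  \<comment> \<open>The same scalar product as an integer, so that 3n - 8 is the square of an
    integer.\<close>
  define w where "w = int n - 2 * int (hamming_dist x y)"
  have "real_of_int w = sprod n x y"
    using sprod_eq_hamming[of x n y] subsetD[OF sub] xy(1,2) by (simp add: w_def)
  with xy have "real_of_int (w\<^sup>2) = real_of_int (3 * int n - 8)" by simp
  then have w2: "w\<^sup>2 = 3 * int n - 8" by (simp only: of_int_eq_iff)
  define m where "m = nat \<bar>w\<bar>"
  have m2: "(int m)\<^sup>2 = 3 * int n - 8" using w2 by (simp add: m_def)
  have "16 dvd card C"
    using M n by (intro sixteen_dvd_card[OF sub]) auto
  then have "16 dvd int (card C)" by presburger
  moreover have "real_of_int (int n * ((int n)\<^sup>2 - 3 * int n + 8)) = real_of_int (6 * int (card C))"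
    using tight(2) by simp
  then have "int n * ((int n)\<^sup>2 - 3 * int n + 8) = 6 * int (card C)"
    by (simp only: of_int_eq_iff)
  \<comment> \<open>The product is 6 times a multiple of 16.\<close>
  ultimately have "32 dvd int n * ((int n)\<^sup>2 - 3 * int n + 8)" by presburger
  from tight_design33_order[OF m2 \<open>even n\<close> this]
  have "[n = 8] (mod 16)" "4 dvd int m" "\<not> 3 dvd int m" by auto
  moreover from this have "4 dvd m" "\<not> 3 dvd m" by presburger+
  moreover have "int (m\<^sup>2 + 8) = int (3 * n)" using m2 by simp
  then have m3: "m\<^sup>2 + 8 = 3 * n" by (simp only: of_nat_eq_iff)
  moreover have "m \<ge> 4"
  proof (rule ccontr)
    assume "\<not> m \<ge> 4"
    then have "m\<^sup>2 \<le> 3\<^sup>2" by (intro power_mono) auto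
    with m3 n show False by simp
  qed
  ultimately show thesis using that[of m] by blast
qed

section \<open>Evaluation of the weights of all words satisfying the Golay recurrence\<close>

text \<open>The recurrence that orthogonality to the shifts of the generator polynomial imposes on the
  coefficients of a word; \<open>p\<close> is the value of the word at the parity coordinate.\<close>
fun golay_extend :: "nat \<Rightarrow> bool \<Rightarrow> bool list \<Rightarrow> bool list" where
  "golay_extend (Suc k) p [b0,b1,b2,b3,b4,b5,b6,b7,b8,b9,b10] =
     b0 # golay_extend k p [b1,b2,b3,b4,b5,b6,b7,b8,b9,b10, b0 \<noteq> (b2 \<noteq> (b4 \<noteq> (b5 \<noteq> (b6 \<noteq> (b10 \<noteq> p)))))]"
| "golay_extend _ p bs = bs"

fun weight :: "bool list \<Rightarrow> nat" where
  "weight [] = 0"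
| "weight (b # bs) = (if b then Suc (weight bs) else weight bs)"

text \<open>A universal quantifier over lists of length k, in a form suited to evaluation. Bits are
  prepended to an accumulator, hence the \<open>rev\<close> in
  \<open>all_extensionsD\<close>.\<close>

fun all_extensions :: "nat \<Rightarrow> bool list \<Rightarrow> (bool list \<Rightarrow> bool) \<Rightarrow> bool" where
  "all_extensions 0 bs P \<longleftrightarrow> P bs"
| "all_extensions (Suc k) bs P \<longleftrightarrow> all_extensions k (True # bs) P \<and> all_extensions k (False # bs) P"

lemma all_extensionsD: "all_extensions (length cs) bs P \<Longrightarrow> P (rev cs @ bs)"
proof (induction cs arbitrary: bs)
  case (Cons c cs)
  then show ?case by (cases c) auto
qed simp

text \<open>The set parity bit itself counts 1, so the weights 2, 4, 6 on 24 coordinates become 1,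
  3, 5 on the other 23.\<close>

lemma weight_golay_extend_True:
  "all_extensions 11 [] (\<lambda>bs. let w = weight (golay_extend 12 True bs) in w \<noteq> 1 \<and> w \<noteq> 3 \<and> w \<noteq> 5)"
  by code_simp

lemma weight_golay_extend_False:
  "all_extensions 11 [] (\<lambda>bs. let w = weight (golay_extend 12 False bs) in w \<noteq> 2 \<and> w \<noteq> 4 \<and> w \<noteq> 6)"
  by code_simp

lemma weight_golay_extend:
  assumes "length bs = 11"
  shows "weight (p # golay_extend 12 p bs) \<notin> {2, 4, 6}"
proof -
  have len: "length (rev bs) = 11" using assms by simp
  from all_extensionsD[of "rev bs" "[]", unfolded len] have all: "all_extensions 11 [] P \<Longrightarrow> P bs" for P
    by simp
  show ?thesis
    using all[OF weight_golay_extend_True] all[OF weight_golay_extend_False]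
    by (cases p) (auto simp: Let_def)
qed

text \<open>Each step shifts the window of eleven values by one; the start \<open>s\<close> is kept
  general for the induction.\<close>

lemma golay_extend_map:
  assumes "\<And>i. s \<le> i \<Longrightarrow> i < s + k \<Longrightarrow>
    b (i + 11) = (b i \<noteq> (b (i + 2) \<noteq> (b (i + 4) \<noteq> (b (i + 5) \<noteq> (b (i + 6) \<noteq> (b (i + 10) \<noteq> p))))))"
  shows "golay_extend k p (map b [s..<s + 11]) = map b [s..<s + k + 11]"
  using assms
proof (induction k arbitrary: s)
  case (Suc k)
  have upt: "[s..<s + 11] = [s, s + 1, s + 2, s + 3, s + 4, s + 5, s + 6, s + 7, s + 8, s + 9, s + 10]" for s
    by (simp add: upt_rec)
  have "golay_extend (Suc k) p (map b [s..<s + 11]) = b s # golay_extend k p (map b [s + 1..<(s + 1) + 11])"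
    using Suc.prems[of s] unfolding upt by (simp add: add.commute eval_nat_numeral)
  also have "\<dots> = b s # map b [s + 1..<(s + 1) + k + 11]"
    using Suc.prems by (subst Suc.IH) auto
  also have "\<dots> = map b [s..<s + Suc k + 11]"
    by (simp add: upt_conv_Cons)
  finally show ?case .
qed (simp add: upt_rec)

lemma weight_map_upt: "weight (map b [0..<n]) = card {i. i < n \<and> b i}"
proof (induction n)
  case (Suc n)
  have "weight (xs @ [c]) = weight xs + of_bool c" for xs c
    by (induction xs) auto
  moreover have "{i. i < Suc n \<and> b i} = {i. i < n \<and> b i} \<union> (if b n then {n} else {})"
    by (auto simp: less_Suc_eq)
  ultimately show ?case using Suc by simp
qed simp

section \<open>Codewords of the extended Golay code\<close>

lemma bit_char_2 [simp]: "b + b = (0 :: bit)"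
  by (cases b) auto

lemma bit_add_eq_0_imp: "a + b = 0 \<Longrightarrow> b = (a :: bit)"
  by (cases a; cases b) simp_all

definition word_poly :: "bit vec \<Rightarrow> bit poly" where
  "word_poly x = (\<Sum>i<23. monom (x $ i) i)"

lemma coeff_word_poly: "coeff (word_poly x) k = (if k < 23 then x $ k else 0)"
  by (simp add: word_poly_def coeff_sum)

lemma degree_word_poly: "degree (word_poly x) < 23"
  using degree_le[of 22 "word_poly x"] by (simp add: coeff_word_poly le_less_trans[of _ 22])

lemma golay_iff:
  "x \<in> standard_extended_golay \<longleftrightarrow> x \<in> F2 24 \<and> golay_poly dvd word_poly x \<and> (\<Sum>i<24. x $ i) = 0"
  by (simp add: standard_extended_golay_def word_poly_def)

lemma golay_add:
  assumes "x \<in> standard_extended_golay" "y \<in> standard_extended_golay"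
  shows "x + y \<in> standard_extended_golay"
proof -
  have d: "x \<in> F2 24" "y \<in> F2 24" using assms by (auto simp: golay_iff)
  have "word_poly (x + y) = word_poly x + word_poly y"
    by (rule poly_eqI) (use d in \<open>auto simp: coeff_word_poly\<close>)
  moreover have "(\<Sum>i<24. (x + y) $ i) = (\<Sum>i<24. x $ i) + (\<Sum>i<24. y $ i)"
    unfolding sum.distrib[symmetric] by (rule sum.cong) (use d in auto)
  ultimately show ?thesis using assms d by (auto simp: golay_iff intro: dvd_add)
qed

lemma golay_ones: "vec 24 (\<lambda>_. 1) \<in> standard_extended_golay"
proof -
  have "word_poly (vec 24 (\<lambda>_. 1)) = Poly (replicate 23 1)"
    by (rule poly_eqI) (simp add: coeff_word_poly coeff_Poly_eq nth_default_def)
  \<comment> \<open>The polynomial (X^23 - 1)/(X - 1) over the two-element field is the generator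
    times its reciprocal polynomial.\<close>
  also have "\<dots> = golay_poly * [:1, 1, 0, 0, 0, 1, 1, 1, 0, 1, 0, 1:]"
    by (simp add: golay_poly_def numeral_eq_Suc)
  finally have "word_poly (vec 24 (\<lambda>_. 1)) = golay_poly * [:1, 1, 0, 0, 0, 1, 1, 1, 0, 1, 0, 1:]" .
  then have "golay_poly dvd word_poly (vec 24 (\<lambda>_. 1))" by (metis dvd_triv_left)
  then show ?thesis by (simp add: golay_iff)
qed

lemma complement_conv: "x \<in> F2 24 \<Longrightarrow> complement x = x + vec 24 (\<lambda>_. 1)"
  by (auto simp: complement_def)

lemma golay_complement: "x \<in> standard_extended_golay \<Longrightarrow> complement x \<in> standard_extended_golay"
  using golay_add[OF _ golay_ones] complement_conv golay_iff by metis

text \<open>The exponents of X^i times the generator, with the parity coordinate 23 added because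
  the generator has seven terms.\<close>

definition golay_gen_support :: "nat \<Rightarrow> nat set" where
  "golay_gen_support i = insert 23 ((+) i ` {0, 2, 4, 5, 6, 10, 11})"

lemma coeff_golay_poly: "coeff golay_poly k = of_bool (k \<in> {0, 2, 4, 5, 6, 10, 11})"
  by (auto simp: golay_poly_def coeff_pCons numeral_eq_Suc split: nat.split)

text \<open>For \<open>i < 12\<close> all exponents stay below 23, so the shifted generator needs no
  cyclic reduction; the weight 8 gives even parity.\<close>

lemma golay_gen:
  assumes "i < 12"
  shows "vec 24 (\<lambda>j. of_bool (j \<in> golay_gen_support i)) \<in> standard_extended_golay"
proof -
  let ?x = "vec 24 (\<lambda>j. of_bool (j \<in> golay_gen_support i)) :: bit vec"
  have "word_poly ?x = monom 1 i * golay_poly"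
  proof (rule poly_eqI)
    fix k
    show "coeff (word_poly ?x) k = coeff (monom 1 i * golay_poly) k"
      using assms
      by (auto simp: coeff_word_poly coeff_monom_mult coeff_golay_poly golay_gen_support_def image_iff)
  qed
  moreover have "golay_gen_support i \<subseteq> {..<24}"
    using assms by (auto simp: golay_gen_support_def)
  then have "(\<Sum>j<24. ?x $ j) = (of_nat (card (golay_gen_support i)) :: bit)"
    by (simp add: sum_of_bool_eq Int_absorb1 flip: Int_def)
  moreover have "card (golay_gen_support i) = 8"
    using assms by (auto simp: golay_gen_support_def card_insert_if)
  ultimately show ?thesis by (simp add: golay_iff)
qed

section \<open>Dual weights and character sums of the Golay code\<close>

text \<open>Both sides are -1 to the power |U \<inter> T|; the right one runs over the explicit
  support of a codeword.\<close>

lemma character_of_bool: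
  assumes "U \<subseteq> {..<n}" "T \<subseteq> {..<n}"
  shows "character U (vec n (\<lambda>j. of_bool (j \<in> T))) = (\<Prod>j\<in>T. bsign (of_bool (j \<in> U)))"
proof -
  have "character U (vec n (\<lambda>j. of_bool (j \<in> T))) = (\<Prod>j<n. bsign (of_bool (j \<in> U \<and> j \<in> T)))"
    unfolding character_def using assms
    by (intro prod.mono_neutral_cong_left) (auto simp: bsign_def)
  also have "\<dots> = (\<Prod>j\<in>T. bsign (of_bool (j \<in> U)))"
    using assms by (intro prod.mono_neutral_cong_right) (auto simp: bsign_def)
  finally show ?thesis .
qed

lemma character_add:
  assumes "x \<in> F2 n" "y \<in> F2 n" "U \<subseteq> {..<n}"
  shows "character U (x + y) = character U x * character U y"
  unfolding character_def prod.distrib[symmetric] bsign_add[symmetric]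
  using assms by (intro prod.cong refl) (simp add: subset_iff)

text \<open>The hypothesis says that the indicator word of \<open>U\<close> is orthogonal to the
  code. Against the twelve shifts of the generator this is the recurrence of
  \<open>golay_extend\<close>, so eleven bits and the parity bit determine \<open>U\<close>.\<close>

lemma dual_golay_weight:
  assumes U: "U \<subseteq> {..<24}" "\<And>x. x \<in> standard_extended_golay \<Longrightarrow> character U x = 1"
  shows "card U \<notin> {2, 4, 6}"
proof -
  define b where "b j \<longleftrightarrow> j \<in> U" for j
  have "b (i + 11) = (b i \<noteq> (b (i + 2) \<noteq> (b (i + 4) \<noteq> (b (i + 5) \<noteq> (b (i + 6) \<noteq> (b (i + 10) \<noteq> b 23))))))"
    if "i < 12" for i
  proof -
    have "golay_gen_support i \<subseteq> {..<24}"
      using that by (auto simp: golay_gen_support_def)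
    then have "(\<Prod>j\<in>golay_gen_support i. bsign (of_bool (b j))) = 1"
      using character_of_bool[OF U(1)] U(2)[OF golay_gen[OF that]] by (simp add: b_def)
    moreover have "golay_gen_support i = {23, i, i + 2, i + 4, i + 5, i + 6, i + 10, i + 11}"
      by (auto simp: golay_gen_support_def)
    ultimately show ?thesis
      using that by (auto simp: bsign_def split: if_splits)
  qed
  then have "golay_extend 12 (b 23) (map b [0..<11]) = map b [0..<23]"
    using golay_extend_map[of 0 12 b "b 23"] by simp
  moreover have "weight (b 23 # golay_extend 12 (b 23) (map b [0..<11])) \<notin> {2, 4, 6}"
    by (rule weight_golay_extend) simp
  ultimately have "of_bool (b 23) + card {i. i < 23 \<and> b i} \<notin> {2, 4, 6}"
    by (simp add: weight_map_upt split: if_splits)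
  moreover have "U = {i. i < 23 \<and> b i} \<union> (if b 23 then {23} else {})"
    using U(1) by (force simp: b_def less_Suc_eq numeral_eq_Suc)
  then have "card U = card ({i. i < 23 \<and> b i} \<union> (if b 23 then {23} else {}))" by simp
  then have "card U = of_bool (b 23) + card {i. i < 23 \<and> b i}" by simp
  ultimately show ?thesis by simp
qed

text \<open>Translation by a codeword \<open>c\<close> permutes the code and multiplies the sum by
  \<open>character U c\<close>, which can be chosen different from 1.\<close>

lemma golay_sum_character:
  assumes "U \<subseteq> {..<24}" "card U \<in> {2, 4, 6}"
  shows "(\<Sum>x\<in>standard_extended_golay. character U x) = 0"
proof -
  let ?G = standard_extended_golay
  have sub: "x \<in> F2 24" if "x \<in> ?G" for x using that by (simp add: golay_iff)
  obtain c where c: "c \<in> ?G" "character U c \<noteq> 1"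
    using dual_golay_weight[OF assms(1)] assms(2) by blast
  have cc: "c + (c + x) = x" if "x \<in> ?G" for x
    using sub[OF that] sub[OF c(1)] by (auto simp flip: add.assoc)
  have "(\<Sum>x\<in>?G. character U x) = (\<Sum>x\<in>?G. character U (c + x))"
    by (rule sum.reindex_bij_witness[of _ "(+) c" "(+) c"]) (use cc c golay_add in auto)
  also have "\<dots> = character U c * (\<Sum>x\<in>?G. character U x)"
    unfolding sum_distrib_left
    using character_add[OF _ _ assms(1)] sub c(1) by (intro sum.cong refl) blast
  finally show ?thesis using c(2) by simp
qed

section \<open>Cardinality of the Golay code\<close>

text \<open>Over the two-element field a polynomial is the set of its exponents. The zero polynomial
  has degree 0, so for \<open>n = 0\<close> the set would be empty.\<close>

lemma card_bit_polys: "n > 0 \<Longrightarrow> card {q :: bit poly. degree q < n} = 2 ^ n"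
proof -
  assume n: "n > 0"
  have c: "coeff (\<Sum>i\<in>S. monom 1 i) k = (of_bool (k \<in> S) :: bit)" if "finite S" for S :: "nat set" and k
    using that by (simp add: coeff_sum)
  have "bij_betw (\<lambda>S. \<Sum>i\<in>S. monom (1 :: bit) i) (Pow {..<n}) {q. degree q < n}"
  proof (rule bij_betw_byWitness[where f' = "\<lambda>q. {i. coeff q i = 1}"])
    show "\<forall>S\<in>Pow {..<n}. {i. coeff (\<Sum>i\<in>S. monom (1 :: bit) i) i = 1} = S"
      using finite_subset[of _ "{..<n}"] by (auto simp: c)
    have f: "{i. coeff q i = 1} \<subseteq> {..<n}" if "degree q < n" for q :: "bit poly"
      using that le_degree[of q] by force
    then show "(\<lambda>q. {i. coeff q i = 1}) ` {q :: bit poly. degree q < n} \<subseteq> Pow {..<n}" by blast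
    show "\<forall>q\<in>{q. degree q < n}. (\<Sum>i\<in>{i. coeff q i = 1}. monom (1 :: bit) i) = q"
      using f finite_subset[of _ "{..<n}"] by (auto intro!: poly_eqI simp: c)
    show "(\<lambda>S. \<Sum>i\<in>S. monom (1 :: bit) i) ` Pow {..<n} \<subseteq> {q. degree q < n}"
      using n finite_subset[of _ "{..<n}"] by (force intro!: degree_lessI simp: c)
  qed
  from bij_betw_same_card[OF this] show ?thesis by (simp add: card_Pow)
qed

lemma degree_golay_poly: "degree golay_poly = 11" "golay_poly \<noteq> 0"
  by (simp_all add: golay_poly_def)

lemma card_golay: "card standard_extended_golay = 4096"
proof -
  define word where "word p = vec 24 (\<lambda>i. if i < 23 then coeff p i else \<Sum>k<23. coeff p k)" for p :: "bit poly"
  have word: "word_poly (word p) = p" if "degree p < 23" for p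
    by (rule poly_eqI) (use that in \<open>auto simp: coeff_word_poly word_def coeff_eq_0\<close>)
  have par: "(\<Sum>k<24. f k) = (\<Sum>k<23. f k) + f 23" for f :: "nat \<Rightarrow> bit"
    using sum.lessThan_Suc[of f 23] by simp
  have deg: "degree (golay_poly * q) < 23 \<longleftrightarrow> degree q < 12" for q
    using degree_golay_poly by (cases "q = 0") (auto simp: degree_mult_eq)
  \<comment> \<open>Encoding multiplies a message polynomial by the generator and appends the parity
    bit; decoding is exact division.\<close>
  have "bij_betw (\<lambda>q. word (golay_poly * q)) {q. degree q < 12} standard_extended_golay"
  proof (rule bij_betw_byWitness[where f' = "\<lambda>x. word_poly x div golay_poly"])
    show "\<forall>q\<in>{q. degree q < 12}. word_poly (word (golay_poly * q)) div golay_poly = q"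
      using degree_golay_poly by (auto simp: word deg)
    show "\<forall>x\<in>standard_extended_golay. word (golay_poly * (word_poly x div golay_poly)) = x"
    proof
      fix x assume x: "x \<in> standard_extended_golay"
      then have q: "golay_poly * (word_poly x div golay_poly) = word_poly x" by (simp add: golay_iff)
      have "(\<Sum>k<23. x $ k) + x $ 23 = 0"
        using x par[of "\<lambda>k. x $ k"] unfolding golay_iff by metis
      then have x23: "x $ 23 = (\<Sum>k<23. x $ k)" by (rule bit_add_eq_0_imp)
      have "dim_vec x = 24" using x by (simp add: golay_iff)
      then show "word (golay_poly * (word_poly x div golay_poly)) = x"
      proof (intro eq_vecI)
        fix i assume "i < dim_vec x"
        then have "i < 23 \<or> i = 23" using \<open>dim_vec x = 24\<close> by auto
        then show "word (golay_poly * (word_poly x div golay_poly)) $ i = x $ i"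
          using q x23 by (auto simp: word_def coeff_word_poly)
      qed (simp add: word_def)
    qed
    show "(\<lambda>q. word (golay_poly * q)) ` {q. degree q < 12} \<subseteq> standard_extended_golay"
    proof (intro image_subsetI)
      fix q :: "bit poly" assume "q \<in> {q. degree q < 12}"
      then have "word_poly (word (golay_poly * q)) = golay_poly * q" by (simp add: word deg)
      moreover have "(\<Sum>k<24. word p $ k) = 0" "word p \<in> F2 24" for p
        unfolding par by (simp_all add: word_def)
      ultimately show "word (golay_poly * q) \<in> standard_extended_golay" by (simp add: golay_iff)
    qed
    show "(\<lambda>x. word_poly x div golay_poly) ` standard_extended_golay \<subseteq> {q. degree q < 12}"
    proof (intro image_subsetI CollectI)
      fix x assume x: "x \<in> standard_extended_golay"
      then have "golay_poly * (word_poly x div golay_poly) = word_poly x" by (simp add: golay_iff)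
      then show "degree (word_poly x div golay_poly) < 12"
        using deg[of "word_poly x div golay_poly"] degree_word_poly[of x] by simp
    qed
  qed
  then have "card standard_extended_golay = card {q :: bit poly. degree q < 12}"
    by (rule bij_betw_same_card[symmetric])
  then show ?thesis by (simp add: card_bit_polys)
qed

section \<open>Permuted Golay codes and halves of complementary pairs\<close>

lemma extended_golay_properties:
  assumes "extended_golay G"
  shows "G \<subseteq> F2 24" "card G = 4096" "\<And>x. x \<in> G \<Longrightarrow> complement x \<in> G"
    and "\<And>U. U \<subseteq> {..<24} \<Longrightarrow> card U \<in> {2, 4, 6} \<Longrightarrow> (\<Sum>x\<in>G. character U x) = 0"
proof -
  let ?G = standard_extended_golay
  obtain p where p: "p permutes {..<24}" and G: "G = (\<lambda>x. vec 24 (\<lambda>i. x $ p i)) ` ?G"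
    using assms by (auto simp: extended_golay_def)
  define f where "f x = vec 24 (\<lambda>i. x $ p i)" for x :: "bit vec"
  note G = G[folded f_def]
  have pl: "p i < 24 \<longleftrightarrow> i < 24" for i using permutes_in_image[OF p, of i] by simp
  have inj: "inj_on f ?G"
  proof (rule inj_onI)
    fix x y assume xy: "x \<in> ?G" "y \<in> ?G" "f x = f y"
    have "x $ i = y $ i" if "i < 24" for i
    proof -
      obtain j where "i = p j" using permutes_surj[OF p] by blast
      then show ?thesis
        using arg_cong[OF xy(3), of "\<lambda>v. v $ j"] that by (simp add: f_def pl)
    qed
    with xy show "x = y" by (auto simp: golay_iff)
  qed
  show "G \<subseteq> F2 24" by (auto simp: G f_def)
  show "card G = 4096" by (simp add: G card_image[OF inj] card_golay)
  show "complement x \<in> G" if "x \<in> G" for x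
  proof -
    obtain y where y: "y \<in> ?G" "x = f y" using \<open>x \<in> G\<close> by (auto simp: G)
    then have "complement x = f (complement y)"
      by (auto simp: complement_def f_def golay_iff pl)
    with y show ?thesis by (simp add: G golay_complement)
  qed
  show "(\<Sum>x\<in>G. character U x) = 0" if U: "U \<subseteq> {..<24}" "card U \<in> {2, 4, 6}" for U
  proof -
    have injp: "inj_on p U" using permutes_inj_on[OF p] .
    have "character U (f x) = character (p ` U) x" for x
      unfolding character_def prod.reindex[OF injp] comp_def
      by (rule prod.cong) (use U in \<open>auto simp: f_def\<close>)
    moreover have "p ` U \<subseteq> {..<24}" "card (p ` U) \<in> {2, 4, 6}"
      using U by (auto simp: pl card_image[OF injp])
    ultimately show ?thesis
      by (simp add: G sum.reindex[OF inj] golay_sum_character)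
  qed
qed

text \<open>An even number of sign changes leaves a character unchanged, so \<open>C\<close> and its
  complements contribute equally to a vanishing sum.\<close>

lemma golay_half_tight_design33:
  assumes G: "extended_golay G" and C: "C \<subseteq> G" and pick: "\<And>x. x \<in> G \<Longrightarrow> card (C \<inter> {x, complement x}) = 1"
  shows "tight_design33 24 C"
proof -
  note golay = extended_golay_properties[OF G]
  have dim: "dim_vec x = 24" if "x \<in> G" for x using golay(1) that by auto
  have cc: "complement (complement x) = x" for x
    by (auto simp: complement_def)
  have ne: "complement x \<noteq> x" if "x \<in> G" for x
  proof
    assume "complement x = x"
    then have "complement x $ 0 = x $ 0" by simp
    then show False using dim[OF that] by (cases "x $ 0") (simp_all add: complement_def)
  qed
  have fin: "finite C" using golay(2) C by (metis card.infinite finite_subset zero_neq_numeral)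
  have disj: "C \<inter> complement ` C = {}"
  proof (rule ccontr)
    assume "C \<inter> complement ` C \<noteq> {}"
    then obtain x where "x \<in> C" "complement x \<in> C" by auto
    then show False using pick[of x] ne[of x] C by (auto simp: insert_absorb Int_insert_right)
  qed
  have un: "G = C \<union> complement ` C"
  proof
    show "G \<subseteq> C \<union> complement ` C"
    proof
      fix x assume "x \<in> G"
      then have "x \<in> C \<or> complement x \<in> C" using pick[of x] by (auto simp: Int_insert_right split: if_splits)
      then show "x \<in> C \<union> complement ` C" using cc by (metis UnI1 UnI2 imageI)
    qed
  qed (use C golay(3) in auto)
  have inj: "inj_on complement C" using cc by (metis inj_onI)
  have "card C = 2048"
    using golay(2) fin disj unfolding un by (simp add: card_Un_disjoint card_image[OF inj])
  have "(\<Sum>x\<in>C. character U x) = 0" if U: "U \<subseteq> {..<24}" "card U \<in> {2, 4, 6}" for U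
  proof -
    have "character U (complement x) = character U x" if "x \<in> C" for x
    proof -
      have "character U (complement x) = (\<Prod>j\<in>U. - bsign (x $ j))"
        unfolding character_def
        using U(1) dim[of x] that C
        by (intro prod.cong refl) (auto simp: complement_def bsign_def subset_iff)
      also have "\<dots> = character U x"
        using U(2) by (auto simp: prod_uminus character_def)
      finally show ?thesis .
    qed
    then have "(\<Sum>x\<in>G. character U x) = 2 * (\<Sum>x\<in>C. character U x)"
      using fin disj unfolding un by (simp add: sum.union_disjoint sum.reindex[OF inj])
    with golay(4)[OF U] show ?thesis by simp
  qed
  then have "real (24 choose k) * moment 24 k C = 0" if "k \<in> {2, 4, 6}" for k
    using moment_eq_sum_squares(1)[OF subset_trans[OF C golay(1)], of k] that by auto
  moreover have "24 choose k \<noteq> 0" if "k \<in> {2, 4, 6}" for k :: nat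
    using that by (auto simp: binomial_eq_0_iff)
  ultimately have "moment 24 k C = 0" if "k \<in> {2, 4, 6}" for k
    using that by (metis mult_eq_0_iff of_nat_eq_0_iff)
  \<comment> \<open>1 + 23 + 253 + 1771 = 2048, half of the 4096 codewords.\<close>
  moreover have "(\<Sum>i=0..3. (24 - 1) choose i) = (2048 :: nat)"
    using sum_choose_upto_3[of 24] by simp
  ultimately show ?thesis
    using golay(1) C \<open>card C = 2048\<close> by (auto simp: tight_design33_def design33_def)
qed

theorem theorem5p4:
  "(\<forall>n::nat. n \<ge> 6 \<longrightarrow> (\<exists>C. tight_design33 n C) \<longrightarrow>
      (\<exists>m::nat. m \<ge> 4 \<and> real n = ((real m)\<^sup>2 + 8) / 3 \<and>
         (([n = 8] (mod 16) \<and> 4 dvd m \<and> \<not> 3 dvd m) \<or>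
          ([n = 107] (mod 128) \<and> [m = 43] (mod 64)))))
   \<and> (\<forall>G C. extended_golay G \<longrightarrow> C \<subseteq> G \<longrightarrow>
        (\<forall>x\<in>G. card (C \<inter> {x, complement x}) = 1) \<longrightarrow>
        tight_design33 24 C)"
proof (intro conjI allI impI)
  fix n :: nat
  assume "n \<ge> 6" "\<exists>C. tight_design33 n C"
  then obtain m where m: "m \<ge> 4" "m\<^sup>2 + 8 = 3 * n" "[n = 8] (mod 16)" "4 dvd m" "\<not> 3 dvd m"
    using tight_design33_parameters by metis
  have "real (m\<^sup>2 + 8) = real (3 * n)" by (simp only: m)
  then have "real n = ((real m)\<^sup>2 + 8) / 3" by simp
  with m show "\<exists>m::nat. m \<ge> 4 \<and> real n = ((real m)\<^sup>2 + 8) / 3 \<and>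
         (([n = 8] (mod 16) \<and> 4 dvd m \<and> \<not> 3 dvd m) \<or>
          ([n = 107] (mod 128) \<and> [m = 43] (mod 64)))"
    by blast
qed (blast intro: golay_half_tight_design33)

end
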